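(* Let $f$ be a $\{0,1\}$-valued binary function. If $f$ is not linear, then $f$ has a proper minor that is not linear.
   Context: A binary function on a finite ground set $E$ is a function $f\colon 2^E\to\mathbb{R}$ with $f(\emptyset)=1$; its order is $|E|$. A binary function $f$ is linear if it is $\{0,1\}$-valued and for all $X,Y\subseteq E$, $f(X)=f(Y)=1$ implies $f(X\triangle Y)=1$ (i.e. $f$ is the indicator function of a binary vector space, identifying subsets with their characteristic vectors). For $X\subseteq E$, the contraction $f/X\colon 2^{E\setminus X}\to\mathbb{R}$ is $f/X(Y)=f(Y)$, and the deletion $f\setminus X\colon 2^{E\setminus X}\to\mathbb{R}$ is $f\setminus X(Y)=\frac{\sum_{Z\subseteq X} f(Y\cup Z)}{\sum_{Z\subseteq X} f(Z)}$, well defined exactly when the denominator is nonzero. A minor of $f$ is a well-defined binary function $(f/X)\setminus Y$ for disjoint $X,Y\subseteq E$; it is proper if its order is less than $|E|$. *)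

theory Defs
  imports Complex_Main "HOL-Library.FuncSet"
begin

text \<open>A function \<open>2\<^sup>E \<rightarrow> \<real>\<close> is represented by a total function on sets that is
  \<^const>\<open>undefined\<close> outside \<open>Pow E\<close>, so that it is determined by its values on subsets of \<open>E\<close>.\<close>

definition binary_function :: "'a set \<Rightarrow> ('a set \<Rightarrow> real) \<Rightarrow> bool" where
  "binary_function E f \<longleftrightarrow> finite E \<and> f \<in> Pow E \<rightarrow>\<^sub>E UNIV \<and> f {} = 1"

definition zero_one_valued :: "'a set \<Rightarrow> ('a set \<Rightarrow> real) \<Rightarrow> bool" where
  "zero_one_valued E f \<longleftrightarrow> (\<forall>X\<subseteq>E. f X \<in> {0, 1})"

definition linear_bf :: "'a set \<Rightarrow> ('a set \<Rightarrow> real) \<Rightarrow> bool" where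
  "linear_bf E f \<longleftrightarrow> zero_one_valued E f \<and>
     (\<forall>X Y. X \<subseteq> E \<and> Y \<subseteq> E \<and> f X = 1 \<and> f Y = 1 \<longrightarrow> f (sym_diff X Y) = 1)"

definition contraction :: "'a set \<Rightarrow> ('a set \<Rightarrow> real) \<Rightarrow> 'a set \<Rightarrow> 'a set \<Rightarrow> real" where
  "contraction E f X = (\<lambda>Y\<in>Pow (E - X). f Y)"

definition deletion_defined :: "('a set \<Rightarrow> real) \<Rightarrow> 'a set \<Rightarrow> bool" where
  "deletion_defined f X \<longleftrightarrow> (\<Sum>Z\<in>Pow X. f Z) \<noteq> 0"

definition deletion :: "'a set \<Rightarrow> ('a set \<Rightarrow> real) \<Rightarrow> 'a set \<Rightarrow> 'a set \<Rightarrow> real" where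
  "deletion E f X = (\<lambda>Y\<in>Pow (E - X). (\<Sum>Z\<in>Pow X. f (Y \<union> Z)) / (\<Sum>Z\<in>Pow X. f Z))"

text \<open>\<open>is_minor E' g E f\<close>: the function \<open>g\<close> on ground set \<open>E'\<close> is a minor of \<open>f\<close> on ground
  set \<open>E\<close>.\<close>

definition is_minor ::
  "'a set \<Rightarrow> ('a set \<Rightarrow> real) \<Rightarrow> 'a set \<Rightarrow> ('a set \<Rightarrow> real) \<Rightarrow> bool" where
  "is_minor E' g E f \<longleftrightarrow>
     (\<exists>X Y. X \<subseteq> E \<and> Y \<subseteq> E \<and> X \<inter> Y = {} \<and>
        deletion_defined (contraction E f X) Y \<and>
        E' = (E - X) - Y \<and> g = deletion (E - X) (contraction E f X) Y)"

definition is_proper_minor ::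
  "'a set \<Rightarrow> ('a set \<Rightarrow> real) \<Rightarrow> 'a set \<Rightarrow> ('a set \<Rightarrow> real) \<Rightarrow> bool" where
  "is_proper_minor E' g E f \<longleftrightarrow> is_minor E' g E f \<and> card E' < card E"

lemma is_minor_binary_function:
  assumes "binary_function E f" and "is_minor E' g E f"
  shows "binary_function E' g"
  using assms
  by (auto simp: binary_function_def is_minor_def deletion_def deletion_defined_def
      PiE_def split: if_splits)

end

theory Submission
  imports Defs
begin

text \<open>Single-element deletions suffice: suppose that all of them are linear. If \<open>f {e} = 1\<close>, then
  \<open>f \<setminus> e\<close> being zero-one-valued forces \<open>f Y = f (Y \<union> {e})\<close>, so \<open>f\<close> inherits linearity from
  \<open>f \<setminus> e\<close>. If \<open>f\<close> vanishes on all singletons, take \<open>X\<close>, \<open>Y\<close> in the support whose symmetric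
  difference \<open>W\<close> is not. Linearity of \<open>f \<setminus> e\<close> puts every neighbour \<open>W \<triangle> {e}\<close> into the support; adding
  \<open>W \<triangle> {a}\<close> and \<open>W\<close> in \<open>f \<setminus> e\<close> shows \<open>(f \<setminus> e) {a} = 1\<close> for all \<open>a \<noteq> e\<close>, whence \<open>f \<setminus> e\<close> is
  constantly \<open>1\<close>. So \<open>f\<close> changes value whenever one element is added, i.e. it is the indicator of
  the even sets, which is linear after all.\<close>

lemma zero_one_valuedD:
  assumes "zero_one_valued E f" "X \<subseteq> E"
  shows "f X \<in> {0, 1}"
  using assms unfolding zero_one_valued_def by blast

lemma linear_bfD:
  assumes "linear_bf E f" "X \<subseteq> E" "Y \<subseteq> E" "f X = 1" "f Y = 1"
  shows "f (sym_diff X Y) = 1"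
  using assms unfolding linear_bf_def by blast

lemma deletion_singleton:
  assumes "Y \<subseteq> E - {e}"
  shows "deletion E f {e} Y = (f Y + f (insert e Y)) / (f {} + f {e})"
  using assms by (simp add: deletion_def Pow_insert add.commute)

lemma deletion_singleton_proper_minor:
  assumes "binary_function E f" "zero_one_valued E f" "e \<in> E"
  shows "is_proper_minor (E - {e}) (deletion E f {e}) E f"
proof -
  have E: "finite E" and f0: "f {} = 1" and ext: "f \<in> extensional (Pow E)"
    using assms(1) by (auto simp: binary_function_def PiE_def)
  have c: "contraction E f {} = f"
    unfolding contraction_def using ext by (simp add: extensional_restrict)
  \<comment> \<open>The denominator of the deletion is \<open>1 + f {e}\<close>, hence 1 or
    2.\<close>
  have "f {e} \<in> {0, 1}"
    using assms(2,3) unfolding zero_one_valued_def by blast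
  then have "deletion_defined f {e}"
    by (auto simp: deletion_defined_def Pow_insert f0)
  then have "is_minor (E - {e}) (deletion E f {e}) E f"
    unfolding is_minor_def using assms(3)
    by (intro exI[of _ "{}"] exI[of _ "{e}"]) (simp add: c)
  moreover have "card (E - {e}) < card E"
    using E assms(3) by (rule card_Diff1_less)
  ultimately show ?thesis
    by (simp add: is_proper_minor_def)
qed

text \<open>The support is closed under symmetric difference, and singletons generate all finite
  sets.\<close>

lemma linear_bf_one_if_singletons_one:
  assumes "linear_bf E f" "f {} = 1" "\<And>a. a \<in> E \<Longrightarrow> f {a} = 1" "finite Y" "Y \<subseteq> E"
  shows "f Y = 1"
  using assms(4,5)
proof (induction Y rule: finite_induct)
  case empty
  then show ?case using assms(2) by simp
next
  case (insert a Y)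
  then have "f (sym_diff Y {a}) = 1"
    using assms(3) by (intro linear_bfD[OF assms(1)]) auto
  moreover have "sym_diff Y {a} = insert a Y"
    using insert.hyps by auto
  ultimately show ?case by simp
qed

lemma linear_bf_if_alternating:
  assumes "finite E" "f {} = 1" "zero_one_valued E f"
    and alt: "\<And>e Y. e \<in> E \<Longrightarrow> Y \<subseteq> E - {e} \<Longrightarrow> f Y + f (insert e Y) = 1"
  shows "linear_bf E f"
proof -
  \<comment> \<open>Adding one element to \<open>Y\<close> switches between \<open>f Y = 1\<close>
    and \<open>f Y = 0\<close>, so the induction needs both cases: an odd \<open>Y\<close> flips the
    value at \<open>X\<close>.\<close>
  have *: "f (sym_diff X Y) = (if f Y = 1 then f X else 1 - f X)"
    if "finite Y" "Y \<subseteq> E" "X \<subseteq> E" for X Y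
    using that
  proof (induction Y rule: finite_induct)
    case empty
    then show ?case using assms(2) by simp
  next
    case (insert e Y)
    have e: "e \<in> E" and Y: "Y \<subseteq> E - {e}"
      using insert by auto
    have 1: "f Y + f (insert e Y) = 1"
      using alt[OF e Y] .
    \<comment> \<open>The two sets differ exactly in \<open>e\<close>; the case split decides which
      one lacks it, as \<open>alt\<close> requires.\<close>
    have "f (sym_diff X Y) + f (sym_diff X (insert e Y)) = 1"
    proof (cases "e \<in> X")
      case True
      have "f (sym_diff X (insert e Y)) + f (insert e (sym_diff X (insert e Y))) = 1"
        using insert.prems True by (intro alt e) auto
      moreover have "insert e (sym_diff X (insert e Y)) = sym_diff X Y"
        using True insert.hyps by auto
      ultimately show ?thesis by simp
    next
      case False
      have "f (sym_diff X Y) + f (insert e (sym_diff X Y)) = 1"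
        using insert.prems insert.hyps False by (intro alt e) auto
      moreover have "insert e (sym_diff X Y) = sym_diff X (insert e Y)"
        using False insert.hyps by auto
      ultimately show ?thesis by simp
    qed
    moreover have "f Y \<in> {0, 1}"
      using assms(3) insert.prems unfolding zero_one_valued_def by blast
    ultimately show ?case
      using insert 1 by (auto split: if_splits)
  qed
  show ?thesis
    unfolding linear_bf_def
  proof (intro conjI allI impI, goal_cases)
    case 1
    show ?case by (rule assms(3))
  next
    case (2 X Y)
    then show ?case using *[of Y X] finite_subset[OF _ assms(1)] by simp
  qed
qed

text \<open>The case split separates the denominators: \<open>f {} + f {e}\<close> is 2 for the
  chosen \<open>e\<close> in the first case, and 1 for every \<open>e\<close> in the second.\<close>

lemma linear_bf_if_deletions_linear:
  assumes E: "finite E" and f0: "f {} = 1" and z: "zero_one_valued E f"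
    and lin: "\<And>e. e \<in> E \<Longrightarrow> linear_bf (E - {e}) (deletion E f {e})"
  shows "linear_bf E f"
proof (cases "\<exists>e\<in>E. f {e} = 1")
  case True
  then obtain e where e: "e \<in> E" "f {e} = 1" by blast
  let ?g = "deletion E f {e}"
  \<comment> \<open>Two values in {0, 1} have an average in {0, 1} only if they agree.\<close>
  have val: "?g (X - {e}) = f X" if "X \<subseteq> E" for X
  proof -
    have Y: "X - {e} \<subseteq> E - {e}" using that by auto
    have "?g (X - {e}) = (f (X - {e}) + f (insert e (X - {e}))) / 2"
      using deletion_singleton[OF Y] e f0 by simp
    moreover have "?g (X - {e}) \<in> {0, 1}"
      using lin[OF e(1)] Y unfolding linear_bf_def zero_one_valued_def by blast
    moreover have "f (X - {e}) \<in> {0, 1}" "f (insert e (X - {e})) \<in> {0, 1}"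
      using that e(1) by (intro zero_one_valuedD[OF z]; auto)+
    ultimately have "?g (X - {e}) = f (X - {e}) \<and> ?g (X - {e}) = f (insert e (X - {e}))"
      by auto
    then show ?thesis
      by (cases "e \<in> X") (auto simp: insert_absorb)
  qed
  have "f (sym_diff X Y) = 1" if "X \<subseteq> E" "Y \<subseteq> E" "f X = 1" "f Y = 1" for X Y
  proof -
    have "?g (sym_diff (X - {e}) (Y - {e})) = 1"
      using that by (intro linear_bfD[OF lin[OF e(1)]]) (auto simp: val)
    moreover have "sym_diff (X - {e}) (Y - {e}) = sym_diff X Y - {e}" by auto
    moreover have "?g (sym_diff X Y - {e}) = f (sym_diff X Y)"
      using that by (intro val) auto
    ultimately show ?thesis by simp
  qed
  then show ?thesis using z unfolding linear_bf_def by blast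
next
  case False
  have fe: "f {e} = 0" if "e \<in> E" for e
    using False z that unfolding zero_one_valued_def by blast
  have g: "deletion E f {e} Y = f Y + f (insert e Y)" if "e \<in> E" "Y \<subseteq> E - {e}" for e Y
    using deletion_singleton[OF that(2)] fe[OF that(1)] f0 by simp
  \<comment> \<open>The deletion is now a plain sum with value 0 or 1, and one of its two terms is
    \<open>f X\<close>.\<close>
  have g1: "deletion E f {e} (X - {e}) = 1" if "e \<in> E" "X \<subseteq> E" "f X = 1" for e X
  proof -
    have Y: "X - {e} \<subseteq> E - {e}" using that by auto
    have "deletion E f {e} (X - {e}) \<in> {0, 1}"
      using lin[OF that(1)] Y unfolding linear_bf_def zero_one_valued_def by blast
    moreover have "f (X - {e}) \<in> {0, 1}" "f (insert e (X - {e})) \<in> {0, 1}"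
      using that by (intro zero_one_valuedD[OF z]; auto)+
    moreover have "f (X - {e}) = 1 \<or> f (insert e (X - {e})) = 1"
      using that(3) by (cases "e \<in> X") (auto simp: insert_absorb)
    ultimately show ?thesis
      using g[OF that(1) Y] by auto
  qed
  show ?thesis
  proof (rule ccontr)
    assume "\<not> linear_bf E f"
    then obtain X Y where XY: "X \<subseteq> E" "Y \<subseteq> E" "f X = 1" "f Y = 1" "f (sym_diff X Y) \<noteq> 1"
      using z unfolding linear_bf_def by blast
    define W where "W = sym_diff X Y"
    have WE: "W \<subseteq> E" using XY unfolding W_def by auto
    have fW: "f W = 0" using z XY(5) WE unfolding W_def zero_one_valued_def by blast
    \<comment> \<open>As \<open>f W = 0\<close>, \<open>g1\<close> cannot be applied to
      \<open>W\<close> itself, only to \<open>X\<close> and \<open>Y\<close>.\<close>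
    have gW: "deletion E f {e} (W - {e}) = 1" if "e \<in> E" for e
    proof -
      have "deletion E f {e} (sym_diff (X - {e}) (Y - {e})) = 1"
        using that XY by (intro linear_bfD[OF lin[OF that]] g1) auto
      moreover have "sym_diff (X - {e}) (Y - {e}) = W - {e}" unfolding W_def by auto
      ultimately show ?thesis by simp
    qed
    \<comment> \<open>In the sum for \<open>W - {a}\<close>, the term \<open>f W\<close> is 0, so
      the neighbour supplies the 1.\<close>
    have nb: "f (sym_diff W {a}) = 1" if a: "a \<in> E" for a
    proof -
      have s: "f (W - {a}) + f (insert a (W - {a})) = 1"
        using g[OF a, of "W - {a}"] gW[OF a] WE by auto
      show ?thesis
      proof (cases "a \<in> W")
        case True
        then have "insert a (W - {a}) = W" "sym_diff W {a} = W - {a}" by auto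
        then show ?thesis using s fW by simp
      next
        case False
        then have "W - {a} = W" "sym_diff W {a} = insert a W" by auto
        then show ?thesis using s fW by simp
      qed
    qed
    have "f Z + f (insert e Z) = 1" if e: "e \<in> E" and Z: "Z \<subseteq> E - {e}" for e Z
    proof -
      let ?g = "deletion E f {e}"
      have "?g {a} = 1" if a: "a \<in> E - {e}" for a
      proof -
        have "?g (sym_diff W {a} - {e}) = 1"
          using a WE by (intro g1 e nb) auto
        then have "?g (sym_diff (W - {e}) (sym_diff W {a} - {e})) = 1"
          using a WE by (intro linear_bfD[OF lin[OF e]] gW e) auto
        moreover have "sym_diff (W - {e}) (sym_diff W {a} - {e}) = {a}" using a by auto
        ultimately show ?thesis by simp
      qed
      moreover have "?g {} = 1" using g[OF e, of "{}"] f0 fe[OF e] by simp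
      moreover have "finite Z" using E Z by (meson finite_Diff finite_subset)
      ultimately have "?g Z = 1"
        using linear_bf_one_if_singletons_one[OF lin[OF e]] Z by blast
      then show ?thesis using g[OF e Z] by simp
    qed
    then have "linear_bf E f"
      using linear_bf_if_alternating[OF E f0 z] by blast
    then show False using \<open>\<not> linear_bf E f\<close> by contradiction
  qed
qed

theorem theorem8:
  fixes E :: "'a set" and f :: "'a set \<Rightarrow> real"
  assumes "binary_function E f"
    and "zero_one_valued E f"
    and "\<not> linear_bf E f"
  shows "\<exists>E' g. is_proper_minor E' g E f \<and> \<not> linear_bf E' g"
proof -
  have "finite E" "f {} = 1"
    using assms(1) by (auto simp: binary_function_def)
  then obtain e where "e \<in> E" "\<not> linear_bf (E - {e}) (deletion E f {e})"
    using linear_bf_if_deletions_linear assms(2,3) by blast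
  then show ?thesis
    using deletion_singleton_proper_minor[OF assms(1,2)] by blast
qed

end
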